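(* Let $f:\mathbb{R}^n\to\mathbb{R}$ be strongly convex with a constant $\mu>0$ and have Lipschitz continuous gradients with a constant $L_f$. Let the sequences $\{\gamma_k\}$ and $\{\delta_k\}$ satisfy $$\gamma_k>0,\quad\delta_k>0,\quad\gamma_{k+1}\delta_{k+1}\le\gamma_k\delta_k\ \text{ for all }k,\qquad\lim_{k\to\infty}\gamma_k=+\infty.$$ Consider the method $$x_{k+1}=x_k-s_k\nabla F_k(x_k)\qquad\text{for }k\ge1,$$ where $x_1\in\mathbb{R}^n$ is an initial point and the stepsizes $s_k>0$ satisfy $$\sum_{k=1}^\infty s_k=\infty,\qquad\sum_{k=1}^\infty s_k^2<\infty.$$ Moreover, assume that $$\lim_{k\to\infty}s_k\gamma_k^2=0,\qquad\lim_{k\to\infty}\frac{\gamma_k\delta_k}{s_k^2}=0.$$ Then the iterates $\{x_k\}$ of the method converge to the solution $x^*$ of the original problem $\min_{x\in X}f(x)$.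
   Context: Original problem: minimize $f(x)$ subject to $x\in X=\{x\in\mathbb{R}^n\mid\langle a_i,x\rangle-b_i\le0,\ i=1,\ldots,m\}$ ($m\ge2$), where $a_i\in\mathbb{R}^n$ are nonzero and $b_i\in\mathbb{R}$. The problem is feasible ($X\neq\emptyset$). Norms are Euclidean. For nonzero $a\in\mathbb{R}^n$, $b\in\mathbb{R}$ and $\delta>0$: $h_\delta(x;a,b)=\frac{\langle a,x\rangle-b}{\|a\|}$ if $\langle a,x\rangle-b>\delta$; $h_\delta(x;a,b)=\frac{(\langle a,x\rangle-b+\delta)^2}{4\delta\|a\|}$ if $-\delta\le\langle a,x\rangle-b\le\delta$; $h_\delta(x;a,b)=0$ if $\langle a,x\rangle-b<-\delta$. This function is differentiable in $x$. The penalized functions are $$F_k(x)=f(x)+\frac{\gamma_k}{m}\sum_{i=1}^mh_{\delta_k}(x;a_i,b_i).$$ *)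

theory Defs
  imports "HOL-Analysis.Analysis"
begin

(* Meaningful only where f is differentiable. *)
definition gradient :: "('a::euclidean_space \<Rightarrow> real) \<Rightarrow> 'a \<Rightarrow> 'a" where
  "gradient f x = (THE D. GDERIV f x :> D)"

lemma gradient_eqI:
  assumes "GDERIV f x :> D"
  shows "gradient f x = D"
  unfolding gradient_def
proof (rule the_equality[where P = "\<lambda>D. GDERIV f x :> D", OF assms])
  fix E assume E: "GDERIV f x :> E"
  have eq: "(\<lambda>h. h \<bullet> E) = (\<lambda>h. h \<bullet> D)"
    by (rule has_derivative_unique[OF E[unfolded gderiv_def] assms[unfolded gderiv_def]])
  have "\<forall>h. h \<bullet> E = h \<bullet> D"
    by (rule allI) (rule fun_cong[OF eq])
  then show "E = D"
    by (rule iffD1[OF vector_eq_ldot])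
qed

lemma GDERIV_gradient:
  assumes "f differentiable (at x)"
  shows "GDERIV f x :> gradient f x"
proof -
  obtain f' where f': "(f has_derivative f') (at x)"
    using assms unfolding differentiable_def by blast
  have "f' h = h \<bullet> adjoint f' 1" for h
    using adjoint_works[OF has_derivative_linear[OF f'], of h 1] by (simp only: inner_real_def mult_1_right)
  then have eq: "f' = (\<lambda>h. h \<bullet> adjoint f' 1)"
    by (rule ext)
  have "GDERIV f x :> adjoint f' 1"
    unfolding gderiv_def by (rule subst[where P = "\<lambda>g. (f has_derivative g) (at x)", OF eq f'])
  then show ?thesis
    using gradient_eqI[of f x] by simp
qed

(* The standard inequality, which does not presuppose differentiability. *)
definition strongly_convex :: "real \<Rightarrow> ('a::real_normed_vector \<Rightarrow> real) \<Rightarrow> bool" where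
  "strongly_convex \<mu> f \<longleftrightarrow>
    (\<forall>x y. \<forall>t\<in>{0..1}. f (t *\<^sub>R x + (1 - t) *\<^sub>R y)
       \<le> t * f x + (1 - t) * f y - \<mu> / 2 * t * (1 - t) * (norm (x - y))\<^sup>2)"

definition feasible_set :: "nat \<Rightarrow> (nat \<Rightarrow> 'a::real_inner) \<Rightarrow> (nat \<Rightarrow> real) \<Rightarrow> 'a set" where
  "feasible_set m a b = {x. \<forall>i\<in>{1..m}. a i \<bullet> x - b i \<le> 0}"

definition huber :: "real \<Rightarrow> 'a::real_inner \<Rightarrow> real \<Rightarrow> 'a \<Rightarrow> real" where
  "huber \<delta> a b x =
    (if a \<bullet> x - b > \<delta> then (a \<bullet> x - b) / norm a
     else if - \<delta> \<le> a \<bullet> x - b then (a \<bullet> x - b + \<delta>)\<^sup>2 / (4 * \<delta> * norm a)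
     else 0)"

definition penalized ::
  "('a::real_inner \<Rightarrow> real) \<Rightarrow> nat \<Rightarrow> (nat \<Rightarrow> 'a) \<Rightarrow> (nat \<Rightarrow> real) \<Rightarrow> real \<Rightarrow> real \<Rightarrow> 'a \<Rightarrow> real" where
  "penalized f m a b \<gamma> \<delta> x = f x + \<gamma> / real m * (\<Sum>i=1..m. huber \<delta> (a i) (b i) x)"

end

theory Submission
  imports Defs
begin

text \<open>
  Let $y$ be the minimizer of $f$ on the feasible set $X$, let $F_k$ be the penalized function and
  $A_k = \|x_k - y\|^2$. The proof is a Lyapunov argument for $A_k$. Expanding the square of
  $x_{k+1} - y$ and using that $F_k$ is strongly convex with the constant of $f$ gives
  \[ A_{k+1} \le (1 - \mu s_k) A_k + 2 s_k (F_k(y) - F_k(x_k)) + s_k^2 \|\nabla F_k(x_k)\|^2. \]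
  The two error terms are of the form $s_k \cdot o(1)$, up to a term that the contraction absorbs:

  \<^item> $F_k(y) \le f(y) + C \gamma_k \delta_k$, because at a feasible point the smoothing adds at most
    a multiple of $\delta_k$ to the penalty (\<open>penalized_le_feasible\<close>), and $\gamma_k \delta_k \to 0$.

  \<^item> $F_k(x_k) \ge f(y) - o(1)$, whatever the points $x_k$ are, because $\inf F_k$ is asymptotically
    at least $f(y)$ as $\gamma_k \to \infty$ (\<open>penalized_lower_bound\<close>). This is a compactness
    argument: $f$ is below $f(y) - \epsilon$ only on a compact set disjoint from $X$, where the
    penalty is bounded away from zero.

  \<^item> $\|\nabla F_k(x_k)\| \le \|\nabla f(y)\| + L \|x_k - y\| + \gamma_k$, since the gradient of each
    smoothed constraint has norm at most one. Hence $s_k^2 \|\nabla F_k(x_k)\|^2$ is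
    $s_k \, (O(s_k + s_k \gamma_k^2) + O(s_k) A_k)$.

  So $A_{k+1} \le (1 - c s_k) A_k + s_k \eta_k$ for large $k$, with $\eta_k \to 0$, and
  $\sum s_k = \infty$ forces $A_k \to 0$ (\<open>perturbed_contraction_tendsto_0\<close>).

  All the properties of $h_\delta$ come from one formula. With $t = \langle a, x \rangle - b$,
  \[ \|a\| \, h_\delta(x; a, b) = \max_{0 \le \theta \le 1} \; \theta (t + \delta) - \delta \theta^2. \]
  As a maximum of affine functions of $t$ it is convex with the maximizing $\theta$ as a subgradient,
  and since this maximizer is Lipschitz in $t$ the subgradient is a derivative,
  at the breakpoints $t = \pm\delta$ as elsewhere.
\<close>

section \<open>Strongly convex functions\<close>

text \<open>
  Dividing the defining inequality on the segment from \<open>x\<close> to \<open>y\<close> by the parameter \<open>t\<close> bounds a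
  difference quotient at \<open>x\<close>; the claim is the limit \<open>t \<rightarrow> 0+\<close>.
\<close>

lemma strongly_convex_first_order:
  fixes f :: "'a::euclidean_space \<Rightarrow> real"
  assumes conv: "strongly_convex \<mu> f" and D: "GDERIV f x :> g"
  shows "f y \<ge> f x + (y - x) \<bullet> g + \<mu> / 2 * (norm (y - x))\<^sup>2"
proof -
  let ?c = "\<lambda>t::real. x + t *\<^sub>R (y - x)"
  have line: "(?c has_derivative (\<lambda>t. t *\<^sub>R (y - x))) (at 0)"
    by (auto intro!: derivative_eq_intros)
  have "((\<lambda>t. f (?c t)) has_derivative (\<lambda>t. (t *\<^sub>R (y - x)) \<bullet> g)) (at 0)"
    using has_derivative_compose[OF line, of f "\<lambda>h. h \<bullet> g"] D by (simp add: gderiv_def)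
  then have "((\<lambda>t. f (?c t)) has_field_derivative (y - x) \<bullet> g) (at 0)"
    by (simp add: has_field_derivative_def mult.commute[of _ "(y - x) \<bullet> g"])
  then have "((\<lambda>t. (f (?c t) - f x) / t) \<longlongrightarrow> (y - x) \<bullet> g) (at 0)"
    by (simp add: DERIV_def)
  then have quot: "((\<lambda>t. (f (?c t) - f x) / t) \<longlongrightarrow> (y - x) \<bullet> g) (at_right 0)"
    by (rule tendsto_mono[OF at_le, rotated]) simp
  have bound: "((\<lambda>t. f y - f x - \<mu> / 2 * (1 - t) * (norm (y - x))\<^sup>2)
      \<longlongrightarrow> f y - f x - \<mu> / 2 * (1 - 0) * (norm (y - x))\<^sup>2) (at_right 0)"
    by (intro tendsto_intros)
  have "(f (?c t) - f x) / t \<le> f y - f x - \<mu> / 2 * (1 - t) * (norm (y - x))\<^sup>2"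
    if "0 < t" "t < 1" for t
  proof -
    have "f (t *\<^sub>R y + (1 - t) *\<^sub>R x)
        \<le> t * f y + (1 - t) * f x - \<mu> / 2 * t * (1 - t) * (norm (y - x))\<^sup>2"
      using conv that by (simp add: strongly_convex_def)
    moreover have "t *\<^sub>R y + (1 - t) *\<^sub>R x = ?c t"
      by (simp add: algebra_simps)
    ultimately have "f (?c t) - f x
        \<le> t * (f y - f x - \<mu> / 2 * (1 - t) * (norm (y - x))\<^sup>2)"
      by (simp add: algebra_simps)
    then show ?thesis
      using \<open>0 < t\<close> by (simp add: divide_le_eq mult.commute)
  qed
  then have "\<forall>\<^sub>F t in at_right 0.
      (f (?c t) - f x) / t \<le> f y - f x - \<mu> / 2 * (1 - t) * (norm (y - x))\<^sup>2"
    unfolding eventually_at_right_field by (intro exI[of _ 1]) auto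
  from tendsto_le[OF _ bound quot this] show ?thesis
    by simp
qed

text \<open>
  The quadratic term of the first-order inequality at the origin outgrows its linear term, so \<open>f\<close>
  is coercive.
\<close>

lemma compact_sublevel_strongly_convex:
  fixes f :: "'a::euclidean_space \<Rightarrow> real"
  assumes "\<mu> > 0" and conv: "strongly_convex \<mu> f" and diff: "\<And>y. f differentiable (at y)"
  shows "compact {x. f x \<le> r}"
proof -
  have cont: "continuous_on UNIV f"
    using diff by (simp add: continuous_on_eq_continuous_at differentiable_imp_continuous_within)
  define g where "g = gradient f 0"
  \<comment> \<open>For \<open>norm x \<ge> 1\<close> the constant terms are at most \<open>norm x\<close> times themselves, so the quadratic
    inequality in \<open>norm x\<close> can be divided by \<open>norm x\<close> and becomes a linear one.\<close>
  have "norm x \<le> max 1 (2 * (\<bar>r\<bar> + \<bar>f 0\<bar> + norm g) / \<mu>)" if "f x \<le> r" for x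
  proof (cases "norm x \<le> 1")
    case False
    have "f x \<ge> f 0 + x \<bullet> g + \<mu> / 2 * (norm x)\<^sup>2"
      using strongly_convex_first_order[OF conv GDERIV_gradient[OF diff], of 0 x] by (simp add: g_def)
    moreover have "x \<bullet> g \<ge> - (norm x * norm g)"
      using Cauchy_Schwarz_ineq2[of x g] by linarith
    moreover have "\<bar>r\<bar> + \<bar>f 0\<bar> \<le> norm x * (\<bar>r\<bar> + \<bar>f 0\<bar>)"
      using False mult_right_mono[of 1 "norm x" "\<bar>r\<bar> + \<bar>f 0\<bar>"] by simp
    ultimately have "norm x * (\<mu> / 2 * norm x) \<le> norm x * (\<bar>r\<bar> + \<bar>f 0\<bar> + norm g)"
      using that by (simp add: algebra_simps power2_eq_square)
    then have "\<mu> / 2 * norm x \<le> \<bar>r\<bar> + \<bar>f 0\<bar> + norm g"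
      by (rule mult_left_le_imp_le) (use False in auto)
    then show ?thesis
      using \<open>\<mu> > 0\<close> by (simp add: field_simps le_max_iff_disj)
  qed simp
  then have "bounded {x. f x \<le> r}"
    by (auto simp: bounded_iff)
  moreover have "closed {x. f x \<le> r}"
    using cont by (intro closed_Collect_le) auto
  ultimately show ?thesis
    by (simp add: compact_eq_bounded_closed)
qed

text \<open>
  The midpoint of two distinct minimizers would have a strictly smaller value.
\<close>

lemma strongly_convex_arg_min_unique:
  fixes f :: "'a::real_inner \<Rightarrow> real"
  assumes "\<mu> > 0" and conv: "strongly_convex \<mu> f" and X: "convex X"
    and y: "is_arg_min f (\<lambda>z. z \<in> X) y" and z: "is_arg_min f (\<lambda>z. z \<in> X) z"
  shows "y = z"
proof (rule ccontr)
  assume "y \<noteq> z"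
  let ?mid = "(1/2) *\<^sub>R y + (1 - 1/2) *\<^sub>R z"
  have "y \<in> X" "z \<in> X"
    using y z by (auto simp: is_arg_min_def)
  then have "?mid \<in> X"
    by (intro convexD[OF X]) auto
  moreover have "f ?mid \<le> 1/2 * f y + (1 - 1/2) * f z - \<mu> / 2 * (1/2) * (1 - 1/2) * (norm (y - z))\<^sup>2"
    using conv[unfolded strongly_convex_def, rule_format, of "1/2" y z] by simp
  moreover have "\<mu> * (norm (y - z))\<^sup>2 > 0"
    using \<open>\<mu> > 0\<close> \<open>y \<noteq> z\<close> by simp
  moreover have "f y = f z"
    using y z \<open>y \<in> X\<close> \<open>z \<in> X\<close> by (meson is_arg_min_def linorder_neqE)
  ultimately show False
    using y by (force simp: is_arg_min_def)
qed

lemma feasible_set_Inter_halfspaces: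
  "feasible_set m a b = (\<Inter>i\<in>{1..m}. {x. a i \<bullet> x \<le> b i})"
  by (auto simp: feasible_set_def)

lemma convex_feasible_set: "convex (feasible_set m a b)"
  unfolding feasible_set_Inter_halfspaces by (intro convex_INT ballI convex_halfspace_le)

lemma closed_feasible_set: "closed (feasible_set m a b)"
  unfolding feasible_set_Inter_halfspaces by (intro closed_INT ballI closed_halfspace_le)

lemma strongly_convex_ex1_arg_min:
  fixes f :: "'a::euclidean_space \<Rightarrow> real"
  assumes "\<mu> > 0" and conv: "strongly_convex \<mu> f" and diff: "\<And>y. f differentiable (at y)"
    and X: "convex X" "closed X" "X \<noteq> {}"
  shows "\<exists>!y. is_arg_min f (\<lambda>z. z \<in> X) y"
proof -
  obtain z where "z \<in> X"
    using X by auto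
  let ?K = "X \<inter> {x. f x \<le> f z}"
  have "compact ?K"
    using assms by (intro closed_Int_compact compact_sublevel_strongly_convex)
  moreover have "?K \<noteq> {}"
    using \<open>z \<in> X\<close> by auto
  moreover have "continuous_on ?K f"
    using diff by (intro continuous_at_imp_continuous_on) (simp add: differentiable_imp_continuous_within)
  ultimately obtain y where y: "y \<in> ?K" and y_min: "\<forall>w\<in>?K. f y \<le> f w"
    using continuous_attains_inf[of ?K f] by auto
  have "f y \<le> f w" if "w \<in> X" for w
    using y y_min that by (cases "f w \<le> f z") auto
  then have "is_arg_min f (\<lambda>z. z \<in> X) y"
    using y by (auto simp: is_arg_min_def not_less)
  then show ?thesis
    using strongly_convex_arg_min_unique[OF \<open>\<mu> > 0\<close> conv X(1)] by blast
qed

section \<open>The smoothed distance to a half-space\<close>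

text \<open>
  The maximizer over \<open>\<theta> \<in> [0, 1]\<close> of the concave function \<open>\<theta> * (t + \<delta>) - \<delta> * \<theta>\<^sup>2\<close>: its critical point,
  clipped to the unit interval. It is the derivative in \<open>t\<close> of the one-variable Huber function.
\<close>
definition huber_slope :: "real \<Rightarrow> real \<Rightarrow> real" where
  "huber_slope \<delta> t = max 0 (min 1 ((t + \<delta>) / (2 * \<delta>)))"

lemma huber_slope_bounds: "0 \<le> huber_slope \<delta> t" "huber_slope \<delta> t \<le> 1"
  by (auto simp: huber_slope_def)

lemma huber_slope_lipschitz:
  assumes "\<delta> > 0"
  shows "\<bar>huber_slope \<delta> u - huber_slope \<delta> t\<bar> \<le> \<bar>u - t\<bar> / (2 * \<delta>)"
proof -
  have "\<bar>huber_slope \<delta> u - huber_slope \<delta> t\<bar> \<le> \<bar>(u + \<delta>) / (2 * \<delta>) - (t + \<delta>) / (2 * \<delta>)\<bar>"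
    by (auto simp: huber_slope_def max_def min_def)
  also have "\<dots> = \<bar>u - t\<bar> / (2 * \<delta>)"
    using assms by (simp add: diff_divide_distrib[symmetric])
  finally show ?thesis .
qed

text \<open>
  For \<open>a \<noteq> 0\<close>, together with \<open>huber_ge_dual\<close>, this says that \<open>norm a * huber \<delta> a b x\<close> is the maximum of
  \<open>\<theta> * (t + \<delta>) - \<delta> * \<theta>\<^sup>2\<close> over \<open>\<theta> \<in> [0, 1]\<close>, where \<open>t = a \<bullet> x - b\<close>.
\<close>

lemma huber_eq_dual:
  assumes "\<delta> > 0"
  shows "huber \<delta> a b x = (huber_slope \<delta> (a \<bullet> x - b) * (a \<bullet> x - b + \<delta>)
      - \<delta> * (huber_slope \<delta> (a \<bullet> x - b))\<^sup>2) / norm a"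
proof -
  define t where "t = a \<bullet> x - b"
  consider "t > \<delta>" | "- \<delta> \<le> t" "t \<le> \<delta>" | "t < - \<delta>"
    by linarith
  then show ?thesis
  proof cases
    case 1
    then have "huber_slope \<delta> t = 1"
      using assms by (simp add: huber_slope_def)
    then show ?thesis
      using 1 by (simp add: huber_def t_def[symmetric])
  next
    case 2
    then have "huber_slope \<delta> t = (t + \<delta>) / (2 * \<delta>)"
      using assms by (simp add: huber_slope_def)
    moreover have "huber_slope \<delta> t * (t + \<delta>) - \<delta> * (huber_slope \<delta> t)\<^sup>2
        = (t + \<delta>)\<^sup>2 / (4 * \<delta>)"
      unfolding \<open>huber_slope \<delta> t = (t + \<delta>) / (2 * \<delta>)\<close> using assms by (simp add: power2_eq_square field_simps)
    ultimately show ?thesis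
      using 2 by (simp add: huber_def t_def[symmetric])
  next
    case 3
    then have "huber_slope \<delta> t = 0"
      using assms by (simp add: huber_slope_def field_simps)
    then show ?thesis
      using 3 assms by (simp add: huber_def t_def[symmetric])
  qed
qed

lemma huber_ge_dual:
  assumes "\<delta> > 0" "0 \<le> \<theta>" "\<theta> \<le> 1"
  shows "(\<theta> * (a \<bullet> x - b + \<delta>) - \<delta> * \<theta>\<^sup>2) / norm a \<le> huber \<delta> a b x"
proof -
  define t where "t = a \<bullet> x - b"
  define \<phi> where "\<phi> = huber_slope \<delta> t"
  \<comment> \<open>The first-order optimality condition for the concave maximization over \<open>[0, 1]\<close>.\<close>
  have "0 \<le> (\<phi> - \<theta>) * (t + \<delta> - 2 * \<delta> * \<phi>)"
  proof -
    have "(t + \<delta>) / (2 * \<delta>) \<le> 0 \<and> \<phi> = 0 \<or> (t + \<delta>) / (2 * \<delta>) \<ge> 1 \<and> \<phi> = 1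
        \<or> \<phi> = (t + \<delta>) / (2 * \<delta>)"
      by (auto simp: \<phi>_def huber_slope_def max_def min_def)
    then consider "t + \<delta> \<le> 0" "\<phi> = 0" | "t + \<delta> \<ge> 2 * \<delta>" "\<phi> = 1" | "2 * \<delta> * \<phi> = t + \<delta>"
      using assms(1) by (auto simp: field_simps)
    then show ?thesis
      using assms by cases (auto intro: mult_nonneg_nonpos mult_nonneg_nonneg simp: mult_le_0_iff)
  qed
  moreover have "0 \<le> \<delta> * (\<phi> - \<theta>)\<^sup>2"
    using assms by simp
  ultimately have "\<theta> * (t + \<delta>) - \<delta> * \<theta>\<^sup>2 \<le> \<phi> * (t + \<delta>) - \<delta> * \<phi>\<^sup>2"
    by (simp add: algebra_simps power2_eq_square)
  then show ?thesis
    by (simp add: huber_eq_dual[OF assms(1)] t_def \<phi>_def divide_right_mono)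
qed

text \<open>
  The smoothing never underestimates the exact penalty, the maximum of the dual values over \<open>\<theta> \<in> {0, 1}\<close> only.
\<close>

lemma huber_ge_hinge:
  assumes "\<delta> > 0"
  shows "max 0 (a \<bullet> x - b) / norm a \<le> huber \<delta> a b x"
  using huber_ge_dual[OF assms, of 0 a x b] huber_ge_dual[OF assms, of 1 a x b]
  by (simp add: max_def)

text \<open>
  For \<open>t \<le> 0\<close> every dual value is at most \<open>\<delta> * \<theta> * (1 - \<theta>) \<le> \<delta> / 4\<close>.
\<close>

lemma huber_le_feasible:
  assumes "\<delta> > 0" "a \<bullet> x \<le> b"
  shows "huber \<delta> a b x \<le> \<delta> / (4 * norm a)"
proof -
  define \<theta> where "\<theta> = huber_slope \<delta> (a \<bullet> x - b)"
  have "\<theta> * (a \<bullet> x - b) \<le> 0"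
    using assms(2) huber_slope_bounds by (auto simp: \<theta>_def intro!: mult_nonneg_nonpos)
  moreover have "0 \<le> \<delta> * (\<theta> - 1/2)\<^sup>2"
    using assms by simp
  ultimately have "\<theta> * (a \<bullet> x - b + \<delta>) - \<delta> * \<theta>\<^sup>2 \<le> \<delta> / 4"
    by (simp add: field_simps power2_eq_square)
  then have "(\<theta> * (a \<bullet> x - b + \<delta>) - \<delta> * \<theta>\<^sup>2) / norm a \<le> \<delta> / 4 / norm a"
    by (rule divide_right_mono) simp
  then show ?thesis
    by (simp add: huber_eq_dual[OF assms(1)] \<theta>_def)
qed

definition huber_gradient :: "real \<Rightarrow> 'a::real_inner \<Rightarrow> real \<Rightarrow> 'a \<Rightarrow> 'a" where
  "huber_gradient \<delta> a b x = (huber_slope \<delta> (a \<bullet> x - b) / norm a) *\<^sub>R a"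

lemma norm_huber_gradient_le_1: "norm (huber_gradient \<delta> a b x) \<le> 1"
  using huber_slope_bounds by (simp add: huber_gradient_def)

text \<open>
  The dual value at the maximizer for \<open>x\<close> is an affine minorant that touches the function at \<open>x\<close>.
\<close>

lemma huber_subgradient:
  assumes "\<delta> > 0"
  shows "huber \<delta> a b x + (y - x) \<bullet> huber_gradient \<delta> a b x \<le> huber \<delta> a b y"
proof -
  define \<theta> where "\<theta> = huber_slope \<delta> (a \<bullet> x - b)"
  have "(y - x) \<bullet> huber_gradient \<delta> a b x = \<theta> * (a \<bullet> y - a \<bullet> x) / norm a"
    by (simp add: huber_gradient_def \<theta>_def inner_diff_right inner_commute[of _ a])
  then have "huber \<delta> a b x + (y - x) \<bullet> huber_gradient \<delta> a b x
      = (\<theta> * (a \<bullet> y - b + \<delta>) - \<delta> * \<theta>\<^sup>2) / norm a"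
    by (simp add: huber_eq_dual[OF assms] \<theta>_def add_divide_distrib[symmetric] algebra_simps)
  also have "\<dots> \<le> huber \<delta> a b y"
    using huber_slope_bounds by (intro huber_ge_dual assms) (auto simp: \<theta>_def)
  finally show ?thesis .
qed

lemma GDERIV_of_quadratic_remainder:
  fixes f :: "'a::real_inner \<Rightarrow> real"
  assumes "\<And>y. \<bar>f y - f x - (y - x) \<bullet> D\<bar> \<le> C * (norm (y - x))\<^sup>2"
  shows "GDERIV f x :> D"
  unfolding gderiv_def
proof (rule has_derivativeI_sandwich[where e = 1 and H = "\<lambda>y. C * norm (y - x)"])
  show "bounded_linear (\<lambda>h. h \<bullet> D)"
    by (rule bounded_linear_inner_left)
  have "((\<lambda>y. C * norm (y - x)) \<longlongrightarrow> C * norm (x - x)) (at x)"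
    by (intro tendsto_intros)
  then show "((\<lambda>y. C * norm (y - x)) \<longlongrightarrow> 0) (at x)"
    by simp
  show "norm (f y - f x - (y - x) \<bullet> D) / norm (y - x) \<le> C * norm (y - x)" if "y \<noteq> x" for y
    using assms[of y] that by (simp add: divide_le_eq power2_eq_square mult.assoc)
qed simp

text \<open>
  The subgradient inequality at \<open>x\<close> bounds the first-order remainder below by \<open>0\<close>. The same
  inequality at \<open>y\<close> bounds it above by \<open>y - x\<close> times the change of the subgradient, which is
  quadratically small because the slope is Lipschitz.
\<close>

lemma GDERIV_huber:
  assumes "\<delta> > 0"
  shows "GDERIV (huber \<delta> a b) x :> huber_gradient \<delta> a b x"
proof (rule GDERIV_of_quadratic_remainder)
  fix y
  define d where "d = huber_slope \<delta> (a \<bullet> y - b) - huber_slope \<delta> (a \<bullet> x - b)"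
  have "\<bar>d\<bar> \<le> \<bar>a \<bullet> (y - x)\<bar> / (2 * \<delta>)"
    using huber_slope_lipschitz[OF assms, of "a \<bullet> y - b" "a \<bullet> x - b"]
    by (simp add: d_def inner_diff_right)
  also have "\<dots> \<le> norm a * norm (y - x) / (2 * \<delta>)"
    using assms by (intro divide_right_mono Cauchy_Schwarz_ineq2) auto
  finally have d: "\<bar>d\<bar> \<le> norm a * norm (y - x) / (2 * \<delta>)" .
  have "huber \<delta> a b y - huber \<delta> a b x - (y - x) \<bullet> huber_gradient \<delta> a b x
      \<le> (y - x) \<bullet> huber_gradient \<delta> a b y - (y - x) \<bullet> huber_gradient \<delta> a b x"
    using huber_subgradient[OF assms, of a b y x]
    by (simp add: inner_diff_left)
  also have "\<dots> = d / norm a * ((y - x) \<bullet> a)"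
    by (simp add: huber_gradient_def d_def diff_divide_distrib left_diff_distrib)
  also have "\<dots> \<le> \<bar>d\<bar> / norm a * (norm (y - x) * norm a)"
  proof -
    have "d / norm a * ((y - x) \<bullet> a) \<le> \<bar>d / norm a\<bar> * \<bar>(y - x) \<bullet> a\<bar>"
      unfolding abs_mult[symmetric] by (rule abs_ge_self)
    also have "\<dots> \<le> \<bar>d\<bar> / norm a * (norm (y - x) * norm a)"
      unfolding abs_divide abs_norm_cancel by (intro mult_left_mono Cauchy_Schwarz_ineq2) simp
    finally show ?thesis .
  qed
  also have "\<dots> \<le> \<bar>d\<bar> * norm (y - x)"
    by (cases "a = 0") auto
  also have "\<dots> \<le> norm a * norm (y - x) / (2 * \<delta>) * norm (y - x)"
    by (intro mult_right_mono d) auto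
  finally have "huber \<delta> a b y - huber \<delta> a b x - (y - x) \<bullet> huber_gradient \<delta> a b x
      \<le> norm a / (2 * \<delta>) * (norm (y - x))\<^sup>2"
    by (simp add: power2_eq_square)
  then show "\<bar>huber \<delta> a b y - huber \<delta> a b x - (y - x) \<bullet> huber_gradient \<delta> a b x\<bar>
      \<le> norm a / (2 * \<delta>) * (norm (y - x))\<^sup>2"
    using huber_subgradient[OF assms, of a b x y] by linarith
qed

section \<open>The penalized functions\<close>

lemma GDERIV_penalized:
  assumes "\<delta> > 0" and f: "GDERIV f x :> g"
  shows "GDERIV (penalized f m a b \<gamma> \<delta>) x
    :> g + (\<gamma> / real m) *\<^sub>R (\<Sum>i=1..m. huber_gradient \<delta> (a i) (b i) x)"
proof -
  have "((\<lambda>y. f y + \<gamma> / real m * (\<Sum>i=1..m. huber \<delta> (a i) (b i) y)) has_derivative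
      (\<lambda>h. h \<bullet> g + \<gamma> / real m * (\<Sum>i=1..m. h \<bullet> huber_gradient \<delta> (a i) (b i) x))) (at x)"
    using f GDERIV_huber[OF \<open>\<delta> > 0\<close>] unfolding gderiv_def
    by (intro has_derivative_add has_derivative_mult_right has_derivative_sum)
  then show ?thesis
    unfolding gderiv_def penalized_def
    by (simp add: inner_add_right inner_sum_right cong: sum.cong)
qed

lemma norm_penalized_gradient_le:
  assumes "m \<ge> 1" "\<gamma> \<ge> 0"
  shows "norm (g + (\<gamma> / real m) *\<^sub>R (\<Sum>i=1..m. huber_gradient \<delta> (a i) (b i) x)) \<le> norm g + \<gamma>"
proof -
  have "norm (\<Sum>i=1..m. huber_gradient \<delta> (a i) (b i) x) \<le> (\<Sum>i=1..m. 1)"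
    by (intro sum_norm_le norm_huber_gradient_le_1)
  then have "\<gamma> / real m * norm (\<Sum>i=1..m. huber_gradient \<delta> (a i) (b i) x) \<le> \<gamma> / real m * real m"
    using assms by (intro mult_left_mono) auto
  then have "norm ((\<gamma> / real m) *\<^sub>R (\<Sum>i=1..m. huber_gradient \<delta> (a i) (b i) x)) \<le> \<gamma>"
    using assms by simp
  then show ?thesis
    using norm_triangle_ineq[of g "(\<gamma> / real m) *\<^sub>R (\<Sum>i=1..m. huber_gradient \<delta> (a i) (b i) x)"]
    by linarith
qed

text \<open>
  The penalty is convex, so the penalized function inherits the strong convexity of \<open>f\<close>, with a
  constant that does not depend on \<open>\<gamma>\<close> and \<open>\<delta>\<close>.
\<close>

lemma penalized_first_order:
  fixes f :: "'a::euclidean_space \<Rightarrow> real"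
  assumes conv: "strongly_convex \<mu> f" and f: "GDERIV f x :> g" and "\<gamma> \<ge> 0" "\<delta> > 0"
  shows "penalized f m a b \<gamma> \<delta> y \<ge> penalized f m a b \<gamma> \<delta> x
    + (y - x) \<bullet> (g + (\<gamma> / real m) *\<^sub>R (\<Sum>i=1..m. huber_gradient \<delta> (a i) (b i) x))
    + \<mu> / 2 * (norm (y - x))\<^sup>2"
proof -
  have "(\<Sum>i=1..m. huber \<delta> (a i) (b i) x + (y - x) \<bullet> huber_gradient \<delta> (a i) (b i) x)
      \<le> (\<Sum>i=1..m. huber \<delta> (a i) (b i) y)"
    by (intro sum_mono huber_subgradient \<open>\<delta> > 0\<close>)
  then have "\<gamma> / real m * ((\<Sum>i=1..m. huber \<delta> (a i) (b i) x)
        + (y - x) \<bullet> (\<Sum>i=1..m. huber_gradient \<delta> (a i) (b i) x))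
      \<le> \<gamma> / real m * (\<Sum>i=1..m. huber \<delta> (a i) (b i) y)"
    using \<open>\<gamma> \<ge> 0\<close> by (intro mult_left_mono) (auto simp: sum.distrib inner_sum_right)
  then show ?thesis
    using strongly_convex_first_order[OF conv f, of y]
    by (simp add: penalized_def inner_add_right distrib_left)
qed

lemma penalized_le_feasible:
  assumes "m \<ge> 1" "\<gamma> \<ge> 0" "\<delta> > 0" and y: "y \<in> feasible_set m a b"
  shows "penalized f m a b \<gamma> \<delta> y \<le> f y + \<gamma> * \<delta> * (\<Sum>i=1..m. 1 / (4 * norm (a i)))"
proof -
  have "(\<Sum>i=1..m. huber \<delta> (a i) (b i) y) \<le> (\<Sum>i=1..m. \<delta> / (4 * norm (a i)))"
    using y by (intro sum_mono huber_le_feasible \<open>\<delta> > 0\<close>) (auto simp: feasible_set_def)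
  also have "\<dots> = \<delta> * (\<Sum>i=1..m. 1 / (4 * norm (a i)))" (is "_ = \<delta> * ?S")
    by (simp add: sum_distrib_left)
  finally have "\<gamma> / real m * (\<Sum>i=1..m. huber \<delta> (a i) (b i) y) \<le> \<gamma> / real m * (\<delta> * ?S)"
    using assms by (intro mult_left_mono) auto
  also have "\<dots> \<le> \<gamma> * (\<delta> * ?S)"
    using assms by (intro mult_right_mono mult_nonneg_nonneg sum_nonneg) (auto simp: divide_le_eq mult_le_cancel_left1)
  finally show ?thesis
    by (simp add: penalized_def mult.assoc)
qed

text \<open>
  Where \<open>f\<close> exceeds \<open>v - \<epsilon>\<close> there is nothing to show. On the compact rest the penalty \<open>P\<close> has no zero,
  hence a positive minimum, and \<open>f\<close> is bounded below; a large multiple of \<open>P\<close> makes up the deficit.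
\<close>

lemma penalty_value_lower_bound:
  fixes f P :: "'a::topological_space \<Rightarrow> real"
  assumes f: "continuous_on UNIV f" and P: "continuous_on UNIV P" "\<And>x. P x \<ge> 0"
    and K: "compact {x. f x \<le> v - \<epsilon>}"
    and v: "\<And>x. P x = 0 \<Longrightarrow> f x \<ge> v" and "\<epsilon> > 0"
  shows "\<exists>\<Gamma>. \<forall>\<gamma>\<ge>\<Gamma>. \<forall>x. f x + \<gamma> * P x \<ge> v - \<epsilon>"
proof (cases "{x. f x \<le> v - \<epsilon>} = {}")
  case True
  then have "v - \<epsilon> \<le> f x" for x
    by (metis (mono_tags, lifting) Collect_empty_eq linorder_linear)
  moreover have "0 \<le> \<gamma> * P x" if "\<gamma> \<ge> 0" for \<gamma> x
    using P(2) that by simp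
  ultimately show ?thesis
    by (intro exI[of _ 0]) (metis add.commute add_increasing)
next
  case False
  obtain y where y: "f y \<le> v - \<epsilon>" "\<And>x. f x \<le> v - \<epsilon> \<Longrightarrow> f y \<le> f x"
    using continuous_attains_inf[OF K False continuous_on_subset[OF f]] by auto
  obtain z where z: "f z \<le> v - \<epsilon>" "\<And>x. f x \<le> v - \<epsilon> \<Longrightarrow> P z \<le> P x"
    using continuous_attains_inf[OF K False continuous_on_subset[OF P(1)]] by auto
  have "P z > 0"
    using v[of z] z(1) P(2)[of z] \<open>\<epsilon> > 0\<close> by (cases "P z = 0") auto
  \<comment> \<open>The largest deficit of \<open>f\<close> divided by the smallest penalty.\<close>
  define \<Gamma> where "\<Gamma> = (v - \<epsilon> - f y) / P z"
  have "\<Gamma> \<ge> 0"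
    using y(1) \<open>P z > 0\<close> by (simp add: \<Gamma>_def)
  have "v - \<epsilon> \<le> f x + \<gamma> * P x" if "\<gamma> \<ge> \<Gamma>" for \<gamma> x
  proof (cases "f x \<le> v - \<epsilon>")
    case True
    have "v - \<epsilon> - f y = \<Gamma> * P z"
      using \<open>P z > 0\<close> by (simp add: \<Gamma>_def)
    also have "\<dots> \<le> \<gamma> * P x"
      using that z(2)[OF True] \<open>\<Gamma> \<ge> 0\<close> \<open>P z > 0\<close> by (intro mult_mono) auto
    finally show ?thesis
      using y(2)[OF True] by linarith
  next
    case False
    moreover have "0 \<le> \<gamma> * P x"
      using P(2) that \<open>\<Gamma> \<ge> 0\<close> by simp
    ultimately show ?thesis
      by linarith
  qed
  then show ?thesis
    by blast
qed

text \<open>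
  The bound is uniform in \<open>\<delta>\<close> because the smoothed penalty dominates the exact one, and uniform in
  \<open>x\<close>, so that it holds along every sequence of iterates.
\<close>

lemma penalized_lower_bound:
  fixes f :: "'a::euclidean_space \<Rightarrow> real"
  assumes "m \<ge> 1" and a: "\<And>i. i \<in> {1..m} \<Longrightarrow> a i \<noteq> 0"
    and "\<mu> > 0" and conv: "strongly_convex \<mu> f" and diff: "\<And>y. f differentiable (at y)"
    and v: "\<And>y. y \<in> feasible_set m a b \<Longrightarrow> v \<le> f y" and "\<epsilon> > 0"
  shows "\<exists>\<Gamma>. \<forall>\<gamma>\<ge>\<Gamma>. \<forall>\<delta>>0. \<forall>x. penalized f m a b \<gamma> \<delta> x \<ge> v - \<epsilon>"
proof -
  define P where "P = (\<lambda>x. (\<Sum>i=1..m. max 0 (a i \<bullet> x - b i) / norm (a i)) / real m)"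
  have "\<exists>\<Gamma>. \<forall>\<gamma>\<ge>\<Gamma>. \<forall>x. f x + \<gamma> * P x \<ge> v - \<epsilon>"
  proof (rule penalty_value_lower_bound)
    show "continuous_on UNIV f"
      using diff by (simp add: continuous_on_eq_continuous_at differentiable_imp_continuous_within)
    show "continuous_on UNIV P"
      unfolding P_def divide_inverse by (intro continuous_intros)
    show "P x \<ge> 0" for x
      unfolding P_def by (intro divide_nonneg_nonneg sum_nonneg) auto
    show "compact {x. f x \<le> v - \<epsilon>}"
      using \<open>\<mu> > 0\<close> conv diff by (rule compact_sublevel_strongly_convex)
    show "v \<le> f x" if "P x = 0" for x
    proof (rule v)
      have "(\<Sum>i=1..m. max 0 (a i \<bullet> x - b i) / norm (a i)) = 0"
        using that \<open>m \<ge> 1\<close> by (simp add: P_def)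
      then have "\<forall>i\<in>{1..m}. max 0 (a i \<bullet> x - b i) / norm (a i) = 0"
        by (subst (asm) sum_nonneg_eq_0_iff) auto
      then show "x \<in> feasible_set m a b"
        using a by (auto simp: feasible_set_def max_def split: if_splits)
    qed
  qed fact
  then obtain \<Gamma> where \<Gamma>: "\<And>\<gamma> x. \<gamma> \<ge> \<Gamma> \<Longrightarrow> f x + \<gamma> * P x \<ge> v - \<epsilon>"
    by blast
  have "penalized f m a b \<gamma> \<delta> x \<ge> v - \<epsilon>" if "\<gamma> \<ge> max 0 \<Gamma>" "\<delta> > 0" for \<gamma> \<delta> x
  proof -
    have "\<gamma> / real m * (\<Sum>i=1..m. max 0 (a i \<bullet> x - b i) / norm (a i))
        \<le> \<gamma> / real m * (\<Sum>i=1..m. huber \<delta> (a i) (b i) x)"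
      using that by (intro mult_left_mono sum_mono huber_ge_hinge) auto
    then show ?thesis
      using \<Gamma>[of \<gamma> x] that by (simp add: penalized_def P_def)
  qed
  then show ?thesis
    by blast
qed

section \<open>Two facts on real sequences\<close>

text \<open>
  Fix \<open>\<epsilon> > 0\<close>. Once \<open>\<eta> k < c * \<epsilon>\<close>, the recursion contracts the excess \<open>A k - \<epsilon>\<close> by the factor
  \<open>1 - c * s k \<le> exp (- c * s k)\<close>, and the product of these factors vanishes because the sum of the
  step sizes diverges.
\<close>

lemma perturbed_contraction_tendsto_0:
  fixes A s \<eta> :: "nat \<Rightarrow> real"
  assumes "c > 0" and A: "\<And>k. A k \<ge> 0"
    and s: "\<forall>\<^sub>F k in sequentially. s k \<ge> 0" "s \<longlonglongrightarrow> 0"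
    and div: "filterlim (\<lambda>N. \<Sum>k=1..N. s k) at_top sequentially"
    and \<eta>: "\<eta> \<longlonglongrightarrow> 0"
    and step: "\<forall>\<^sub>F k in sequentially. A (k + 1) \<le> (1 - c * s k) * A k + s k * \<eta> k"
  shows "A \<longlonglongrightarrow> 0"
proof (rule order_tendstoI)
  fix r :: real assume "r > 0"
  define \<epsilon> where "\<epsilon> = r / 2"
  have "\<epsilon> > 0"
    using \<open>r > 0\<close> by (simp add: \<epsilon>_def)
  have "\<forall>\<^sub>F k in sequentially. c * s k < 1"
    using tendsto_mult_right_zero[OF s(2), of c] by (auto dest: order_tendstoD(2)[where a = 1])
  moreover have "\<forall>\<^sub>F k in sequentially. \<eta> k < c * \<epsilon>"
    using \<eta> \<open>c > 0\<close> \<open>\<epsilon> > 0\<close> by (intro order_tendstoD(2)) auto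
  ultimately have "\<forall>\<^sub>F k in sequentially. s k \<ge> 0 \<and> c * s k < 1 \<and> \<eta> k < c * \<epsilon>
      \<and> A (k + 1) \<le> (1 - c * s k) * A k + s k * \<eta> k"
    using s(1) step by eventually_elim simp
  then obtain N where N: "\<And>k. k \<ge> N \<Longrightarrow> s k \<ge> 0" "\<And>k. k \<ge> N \<Longrightarrow> c * s k < 1"
      "\<And>k. k \<ge> N \<Longrightarrow> \<eta> k < c * \<epsilon>"
      "\<And>k. k \<ge> N \<Longrightarrow> A (k + 1) \<le> (1 - c * s k) * A k + s k * \<eta> k"
    unfolding eventually_sequentially by blast
  \<comment> \<open>\<open>S\<close> sums from \<open>1\<close>, whereas the contraction holds from \<open>N\<close> on only; \<open>C\<close> compensates the first terms.\<close>
  define S where "S = (\<lambda>n. \<Sum>k=1..n. s k)"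
  define C where "C = A (Suc N) * exp (c * S N)"
  have excess: "A (Suc k) - \<epsilon> \<le> C * exp (- c * S k)" if "k \<ge> N" for k
    using that
  proof (induction k rule: dec_induct)
    case base
    then show ?case
      using \<open>\<epsilon> > 0\<close> by (simp add: C_def mult.assoc flip: exp_add)
  next
    case (step k)
    have nn: "0 \<le> 1 - c * s (Suc k)" and s0: "s (Suc k) \<ge> 0"
      using N[of "Suc k"] step(1) by auto
    have "0 \<le> C"
      using A by (simp add: C_def)
    have "s (Suc k) * \<eta> (Suc k) \<le> s (Suc k) * (c * \<epsilon>)"
      using N(3)[of "Suc k"] step(1) s0 by (intro mult_left_mono) auto
    then have "A (Suc (Suc k)) - \<epsilon> \<le> (1 - c * s (Suc k)) * (A (Suc k) - \<epsilon>)"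
      using N(4)[of "Suc k"] step(1) by (simp add: algebra_simps)
    also have "\<dots> \<le> (1 - c * s (Suc k)) * (C * exp (- c * S k))"
      by (rule mult_left_mono[OF step.IH nn])
    also have "\<dots> \<le> exp (- (c * s (Suc k))) * (C * exp (- c * S k))"
      using exp_ge_add_one_self[of "- (c * s (Suc k))"] \<open>0 \<le> C\<close> by (intro mult_right_mono) auto
    also have "\<dots> = C * exp (- c * S (Suc k))"
      by (simp add: S_def exp_add[symmetric] algebra_simps)
    finally show ?case .
  qed
  have "filterlim (\<lambda>k. c * S k) at_top sequentially"
    unfolding S_def by (rule filterlim_tendsto_pos_mult_at_top[OF tendsto_const \<open>c > 0\<close> div])
  then have "((\<lambda>k. exp (- (c * S k))) \<longlongrightarrow> 0) sequentially"
    by (intro filterlim_compose[OF exp_at_bot]) (simp add: filterlim_uminus_at_top)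
  then have "(\<lambda>k. C * exp (- c * S k)) \<longlonglongrightarrow> 0"
    by (intro tendsto_mult_right_zero) simp
  then have "\<forall>\<^sub>F k in sequentially. C * exp (- c * S k) < \<epsilon>"
    using \<open>\<epsilon> > 0\<close> by (rule order_tendstoD(2))
  with eventually_ge_at_top[of N] have "\<forall>\<^sub>F k in sequentially. A (Suc k) < r"
    by eventually_elim (use excess in \<open>fastforce simp: \<epsilon>_def\<close>)
  then show "\<forall>\<^sub>F k in sequentially. A k < r"
    by (subst (asm) eventually_sequentially_Suc)
qed (auto intro!: always_eventually less_le_trans[OF _ A])

text \<open>
  Turns the family of statements \<open>D k \<ge> - \<epsilon>\<close> into a single null sequence, as the recursion needs.
\<close>

lemma vanishing_error_of_eventual_lower_bounds:
  fixes D :: "nat \<Rightarrow> real"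
  assumes "\<And>\<epsilon>. \<epsilon> > 0 \<Longrightarrow> \<forall>\<^sub>F k in sequentially. D k \<ge> - \<epsilon>"
  shows "(\<lambda>k. max 0 (- D k)) \<longlonglongrightarrow> 0"
proof (rule order_tendstoI)
  fix r :: real assume "r > 0"
  then have "\<forall>\<^sub>F k in sequentially. D k \<ge> - (r / 2)"
    by (intro assms) simp
  then show "\<forall>\<^sub>F k in sequentially. max 0 (- D k) < r"
    by eventually_elim (use \<open>r > 0\<close> in auto)
qed (auto intro: always_eventually)

section \<open>Convergence of the penalty method\<close>

lemma norm_gradient_step_sq:
  fixes x y g :: "'a::real_inner"
  shows "(norm (x - s *\<^sub>R g - y))\<^sup>2 = (norm (x - y))\<^sup>2 + 2 * s * ((y - x) \<bullet> g) + s\<^sup>2 * (norm g)\<^sup>2"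
proof -
  have "x - s *\<^sub>R g - y = (x - y) - s *\<^sub>R g"
    by simp
  then show ?thesis
    unfolding power2_norm_eq_inner
    by (simp add: inner_diff_left inner_diff_right inner_commute algebra_simps power2_eq_square)
qed

theorem proposition5p4:
  fixes f :: "real ^ 'n \<Rightarrow> real"
    and a :: "nat \<Rightarrow> real ^ 'n" and b :: "nat \<Rightarrow> real" and m :: nat
    and \<mu> L :: real
    and \<gamma> \<delta> s :: "nat \<Rightarrow> real"
    and x :: "nat \<Rightarrow> real ^ 'n"
  assumes "m \<ge> 2"
    and "\<And>i. i \<in> {1..m} \<Longrightarrow> a i \<noteq> 0"
    and "feasible_set m a b \<noteq> {}"
    and "\<mu> > 0" and "strongly_convex \<mu> f"
    and "\<And>y. f differentiable (at y)" and "L-lipschitz_on UNIV (gradient f)"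
    and "\<And>k. k \<ge> 1 \<Longrightarrow> \<gamma> k > 0"
    and "\<And>k. k \<ge> 1 \<Longrightarrow> \<delta> k > 0"
    and "\<And>k. k \<ge> 1 \<Longrightarrow> \<gamma> (k + 1) * \<delta> (k + 1) \<le> \<gamma> k * \<delta> k"
    and "filterlim \<gamma> at_top sequentially"
    and "\<And>k. k \<ge> 1 \<Longrightarrow>
          x (k + 1) = x k - s k *\<^sub>R gradient (penalized f m a b (\<gamma> k) (\<delta> k)) (x k)"
    and "\<And>k. k \<ge> 1 \<Longrightarrow> s k > 0"
    and "filterlim (\<lambda>N. \<Sum>k=1..N. s k) at_top sequentially"
    and "summable (\<lambda>k. (s (k + 1))\<^sup>2)"
    and "(\<lambda>k. s k * (\<gamma> k)\<^sup>2) \<longlonglongrightarrow> 0"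
    and "(\<lambda>k. \<gamma> k * \<delta> k / (s k)\<^sup>2) \<longlonglongrightarrow> 0"
  shows "\<exists>xstar. (\<forall>y. is_arg_min f (\<lambda>z. z \<in> feasible_set m a b) y \<longleftrightarrow> y = xstar) \<and> x \<longlonglongrightarrow> xstar"
proof -
  note m = assms(1) and a = assms(2) and X_ne = assms(3) and mu = assms(4)
    and conv = assms(5) and diff = assms(6) and lip = assms(7)
    and \<gamma>_pos = assms(8) and \<delta>_pos = assms(9) and \<gamma>_lim = assms(11) and iter = assms(12)
    and s_pos = assms(13) and s_div = assms(14) and s_sq = assms(15)
    and s\<gamma> = assms(16) and \<gamma>\<delta>s = assms(17)
  obtain y where y: "is_arg_min f (\<lambda>z. z \<in> feasible_set m a b) y"
      "\<And>z. is_arg_min f (\<lambda>z. z \<in> feasible_set m a b) z \<Longrightarrow> z = y"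
    using strongly_convex_ex1_arg_min[OF mu conv diff convex_feasible_set closed_feasible_set X_ne]
    by blast
  have y_feas: "y \<in> feasible_set m a b" and y_min: "\<And>z. z \<in> feasible_set m a b \<Longrightarrow> f y \<le> f z"
    using y(1) by (auto simp: is_arg_min_def not_less)
  define F where "F = (\<lambda>k. penalized f m a b (\<gamma> k) (\<delta> k))"
  define A where "A = (\<lambda>k. (norm (x k - y))\<^sup>2)"
  define G where "G = norm (gradient f y)"
  define C where "C = (\<Sum>i=1..m. 1 / (4 * norm (a i)))"
  define err where "err = (\<lambda>k. max 0 (- (F k (x k) - f y)))"
  define \<eta> where "\<eta> = (\<lambda>k. 2 * (err k + \<gamma> k * \<delta> k * C) + 3 * (s k * G\<^sup>2 + s k * (\<gamma> k)\<^sup>2))"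
  \<comment> \<open>Square summability gives \<open>s k \<rightarrow> 0\<close>, so \<open>\<gamma> k * \<delta> k\<close> vanishes, being \<open>o((s k)\<^sup>2)\<close>.\<close>
  have "(\<lambda>k. (s (k + 1))\<^sup>2) \<longlonglongrightarrow> 0"
    using s_sq by (rule summable_LIMSEQ_zero)
  then have "(\<lambda>k. sqrt ((s (Suc k))\<^sup>2)) \<longlonglongrightarrow> sqrt 0"
    by (intro tendsto_real_sqrt) simp
  then have "(\<lambda>k. s (Suc k)) \<longlonglongrightarrow> 0"
    by (simp add: tendsto_rabs_zero_iff)
  then have s_lim: "s \<longlonglongrightarrow> 0"
    by (subst (asm) filterlim_sequentially_Suc)
  have "(\<lambda>k. \<gamma> k * \<delta> k / (s k)\<^sup>2 * (s k)\<^sup>2) \<longlonglongrightarrow> 0 * 0\<^sup>2"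
    by (intro tendsto_intros \<gamma>\<delta>s s_lim)
  moreover have "\<forall>\<^sub>F k in sequentially. \<gamma> k * \<delta> k / (s k)\<^sup>2 * (s k)\<^sup>2 = \<gamma> k * \<delta> k"
    using eventually_ge_at_top[of 1] by eventually_elim (use s_pos in \<open>simp add: less_le\<close>)
  ultimately have \<gamma>\<delta>: "(\<lambda>k. \<gamma> k * \<delta> k) \<longlonglongrightarrow> 0"
    by (simp add: filterlim_cong)
  have "err \<longlonglongrightarrow> 0"
    unfolding err_def
  proof (rule vanishing_error_of_eventual_lower_bounds)
    fix \<epsilon> :: real assume "\<epsilon> > 0"
    then obtain \<Gamma> where \<Gamma>: "\<And>\<gamma> \<delta> z. \<gamma> \<ge> \<Gamma> \<Longrightarrow> \<delta> > 0 \<Longrightarrow> penalized f m a b \<gamma> \<delta> z \<ge> f y - \<epsilon>"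
      using penalized_lower_bound[where a = a and b = b and m = m, OF _ a mu conv diff y_min \<open>\<epsilon> > 0\<close>] m by fastforce
    have "\<forall>\<^sub>F k in sequentially. \<gamma> k \<ge> \<Gamma>"
      using \<gamma>_lim by (simp add: filterlim_at_top)
    then show "\<forall>\<^sub>F k in sequentially. - \<epsilon> \<le> F k (x k) - f y"
      using eventually_ge_at_top[of 1] unfolding F_def
      
    proof eventually_elim
      case (elim k)
      then show ?case
        using \<Gamma>[of "\<gamma> k" "\<delta> k" "x k"] \<delta>_pos[of k] by linarith
    qed
  qed
  then have "\<eta> \<longlonglongrightarrow> 2 * (0 + 0 * C) + 3 * (0 * G\<^sup>2 + 0)"
    unfolding \<eta>_def by (intro tendsto_intros \<gamma>\<delta> s_lim s\<gamma>)
  then have \<eta>_lim: "\<eta> \<longlonglongrightarrow> 0"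
    by simp
  \<comment> \<open>The last term of the contraction factor and the factor \<open>3\<close> in \<open>\<eta>\<close> come from bounding the squared
    gradient norm, a square of three summands, by three times the sum of their squares.\<close>
  have step: "A (k + 1) \<le> (1 - \<mu> * s k + 3 * L\<^sup>2 * (s k)\<^sup>2) * A k + s k * \<eta> k" if "k \<ge> 1" for k
  proof -
    define g where "g = gradient f (x k)"
    define h where "h = g + (\<gamma> k / real m) *\<^sub>R (\<Sum>i=1..m. huber_gradient (\<delta> k) (a i) (b i) (x k))"
    have g: "GDERIV f (x k) :> g"
      unfolding g_def by (rule GDERIV_gradient[OF diff])
    have "gradient (F k) (x k) = h"
      unfolding F_def h_def by (rule gradient_eqI[OF GDERIV_penalized[OF \<delta>_pos[OF that] g]])
    then have "A (k + 1) = A k + 2 * s k * ((y - x k) \<bullet> h) + (s k)\<^sup>2 * (norm h)\<^sup>2"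
      using iter[OF that] by (simp add: A_def F_def norm_gradient_step_sq)
    moreover have "(y - x k) \<bullet> h \<le> err k + \<gamma> k * \<delta> k * C - \<mu> / 2 * A k"
    proof -
      have "F k (x k) + (y - x k) \<bullet> h + \<mu> / 2 * A k \<le> F k y"
        using penalized_first_order[OF conv g, of "\<gamma> k" "\<delta> k" m a b y] \<gamma>_pos[OF that] \<delta>_pos[OF that]
        by (simp add: F_def h_def A_def norm_minus_commute)
      moreover have "F k y \<le> f y + \<gamma> k * \<delta> k * C"
        unfolding F_def C_def
        using \<gamma>_pos[OF that] \<delta>_pos[OF that] y_feas m by (intro penalized_le_feasible) auto
      moreover have "f y - F k (x k) \<le> err k"
        by (simp add: err_def)
      ultimately show ?thesis
        by linarith
    qed
    then have "2 * s k * ((y - x k) \<bullet> h) \<le> 2 * s k * (err k + \<gamma> k * \<delta> k * C - \<mu> / 2 * A k)"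
      using s_pos[OF that] by (intro mult_left_mono) auto
    moreover have "(norm h)\<^sup>2 \<le> 3 * (G\<^sup>2 + L\<^sup>2 * A k + (\<gamma> k)\<^sup>2)"
    proof -
      have "norm h \<le> norm g + \<gamma> k"
        unfolding h_def using m \<gamma>_pos[OF that] by (intro norm_penalized_gradient_le) auto
      moreover have "norm (g - gradient f y) \<le> L * norm (x k - y)"
        using lipschitz_onD[OF lip, of "x k" y] by (simp add: g_def dist_norm)
      moreover have "norm g \<le> norm (g - gradient f y) + G"
        unfolding G_def using norm_triangle_ineq[of "g - gradient f y" "gradient f y"] by simp
      ultimately have "norm h \<le> G + L * norm (x k - y) + \<gamma> k"
        by linarith
      then have "(norm h)\<^sup>2 \<le> (G + L * norm (x k - y) + \<gamma> k)\<^sup>2"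
        by (intro power_mono) auto
      also have "\<dots> \<le> 3 * (G\<^sup>2 + (L * norm (x k - y))\<^sup>2 + (\<gamma> k)\<^sup>2)"
      proof -
        have "(p + q + r)\<^sup>2 \<le> 3 * (p\<^sup>2 + q\<^sup>2 + r\<^sup>2)" for p q r :: real
          using sum_squares_ge_zero[of "p - q" "q - r"] zero_le_power2[of "p - r"]
          by (simp add: power2_eq_square algebra_simps)
        then show ?thesis .
      qed
      finally show ?thesis
        by (simp add: A_def power_mult_distrib)
    qed
    then have "(s k)\<^sup>2 * (norm h)\<^sup>2 \<le> (s k)\<^sup>2 * (3 * (G\<^sup>2 + L\<^sup>2 * A k + (\<gamma> k)\<^sup>2))"
      by (rule mult_left_mono) simp
    ultimately have "A (k + 1) \<le> A k + 2 * s k * (err k + \<gamma> k * \<delta> k * C - \<mu> / 2 * A k)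
        + (s k)\<^sup>2 * (3 * (G\<^sup>2 + L\<^sup>2 * A k + (\<gamma> k)\<^sup>2))"
      by linarith
    also have "\<dots> = (1 - \<mu> * s k + 3 * L\<^sup>2 * (s k)\<^sup>2) * A k + s k * \<eta> k"
      by (simp add: \<eta>_def algebra_simps power2_eq_square)
    finally show ?thesis .
  qed
  \<comment> \<open>Half of the contraction absorbs the term that is quadratic in \<open>s k\<close>.\<close>
  have "(\<lambda>k. 3 * L\<^sup>2 * s k) \<longlonglongrightarrow> 0"
    by (rule tendsto_mult_right_zero[OF s_lim])
  then have small: "\<forall>\<^sub>F k in sequentially. 3 * L\<^sup>2 * s k < \<mu> / 2"
    using mu by (intro order_tendstoD(2)) auto
  have "A \<longlonglongrightarrow> 0"
  proof (rule perturbed_contraction_tendsto_0[OF _ _ _ s_lim s_div \<eta>_lim])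
    show "0 < \<mu> / 2" "0 \<le> A k" for k
      using mu by (auto simp: A_def)
    show "\<forall>\<^sub>F k in sequentially. 0 \<le> s k"
      using eventually_ge_at_top[of 1] by eventually_elim (use s_pos in \<open>simp add: less_imp_le\<close>)
    show "\<forall>\<^sub>F k in sequentially. A (k + 1) \<le> (1 - \<mu> / 2 * s k) * A k + s k * \<eta> k"
      using small eventually_ge_at_top[of 1]
    proof eventually_elim
      case (elim k)
      have "3 * L\<^sup>2 * s k * s k \<le> \<mu> / 2 * s k"
        using elim s_pos[of k] by (intro mult_right_mono) auto
      then have "(1 - \<mu> * s k + 3 * L\<^sup>2 * (s k)\<^sup>2) * A k \<le> (1 - \<mu> / 2 * s k) * A k"
        by (intro mult_right_mono) (auto simp: A_def power2_eq_square)
      then show ?case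
        using step[of k] elim by linarith
    qed
  qed
  then have "(\<lambda>k. sqrt (A k)) \<longlonglongrightarrow> sqrt 0"
    by (rule tendsto_real_sqrt)
  then have "x \<longlonglongrightarrow> y"
    by (simp add: A_def tendsto_norm_zero_iff LIM_zero_iff)
  then show ?thesis
    using y by blast
qed

end
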